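(* Let $T$ be an $n$-tournament with Seidel adjacency matrix $S$. If $n\equiv 3 \pmod 4$, then the following assertions are equivalent: 1. $T$ has $\frac{1}{96}n(n-1)(n-3)(n+1)$ diamonds. 2. There exists a diagonal matrix $D$ with diagonal entries in $\{-1,1\}$ such that $DS^2D+nI_n=J_n$. 3. $T$ is switching equivalent to a doubly regular tournament.
   Context: An $n$-tournament is a tournament (an orientation of a complete graph) with $n$ vertices; if the arc between $i$ and $j$ is directed from $i$ to $j$, we say $i$ dominates $j$. A diamond is a $4$-tournament consisting of a vertex that dominates, or is dominated by, all three vertices of a $3$-cycle; the number of diamonds in $T$ is the number of $4$-subsets of vertices of $T$ inducing a diamond. With respect to a labelling of the vertices by $1,\dots,n$, the adjacency matrix of $T$ is the $n\times n$ matrix $A=(a_{ij})$ with $a_{ij}=1$ if $i$ dominates $j$ and $a_{ij}=0$ otherwise, and the Seidel adjacency matrix of $T$ is $S=A-A^{t}$. $I_n$ is the identity matrix and $J_n$ the $n\times n$ all-ones matrix. For a tournament $T$ on vertex set $V$ and $X\subseteq V$, the switching $T_X$ of $T$ according to $X$ is the tournament obtained by reversing all arcs between $X$ and $V\setminus X$; two tournaments $T,T'$ on $V$ are switching equivalent if $T_X=T'$ for some $X\subseteq V$. A tournament $T$ is doubly regular if there is a constant $h$ such that, for all distinct vertices $i\neq j$, the number of vertices dominated by both $i$ and $j$ equals $h$. *)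

theory Defs
  imports
    Complex_Main
    "Graph_Theory.Graph_Theory"
    "Jordan_Normal_Form.Matrix"
begin

locale tournament = digraph +
  assumes one_orientation:
    "u \<in> verts G \<Longrightarrow> v \<in> verts G \<Longrightarrow> u \<noteq> v \<Longrightarrow> u \<rightarrow>\<^bsub>G\<^esub> v \<longleftrightarrow> \<not> v \<rightarrow>\<^bsub>G\<^esub> u"

definition n_tournament :: "nat \<Rightarrow> ('a, 'b) pre_digraph \<Rightarrow> bool" where
  "n_tournament n G \<longleftrightarrow> tournament G \<and> card (verts G) = n"

text \<open>The four vertices below are distinct, since a 4-tournament has 4 vertices.\<close>

definition diamond :: "('a, 'b) pre_digraph \<Rightarrow> bool" where
  "diamond G \<longleftrightarrow> n_tournament 4 G \<and>
     (\<exists>v a b c. verts G = {v, a, b, c} \<and>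
        a \<rightarrow>\<^bsub>G\<^esub> b \<and> b \<rightarrow>\<^bsub>G\<^esub> c \<and> c \<rightarrow>\<^bsub>G\<^esub> a \<and>
        ((\<forall>x\<in>{a, b, c}. v \<rightarrow>\<^bsub>G\<^esub> x) \<or> (\<forall>x\<in>{a, b, c}. x \<rightarrow>\<^bsub>G\<^esub> v)))"

definition num_diamonds :: "('a, 'b) pre_digraph \<Rightarrow> nat" where
  "num_diamonds G = card {X. X \<subseteq> verts G \<and> card X = 4 \<and> diamond (G \<restriction> X)}"

text \<open>
  A labelling of the vertices is a bijection \<open>lab\<close> from \<open>{0..<n}\<close> onto the vertex set;
  it starts at 0 to match the indexing of matrices.
\<close>

definition adjacency_mat :: "nat \<Rightarrow> (nat \<Rightarrow> 'a) \<Rightarrow> ('a, 'b) pre_digraph \<Rightarrow> real mat" where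
  "adjacency_mat n lab G = mat n n (\<lambda>(i, j). if lab i \<rightarrow>\<^bsub>G\<^esub> lab j then 1 else 0)"

definition seidel_mat :: "nat \<Rightarrow> (nat \<Rightarrow> 'a) \<Rightarrow> ('a, 'b) pre_digraph \<Rightarrow> real mat" where
  "seidel_mat n lab G = adjacency_mat n lab G - transpose_mat (adjacency_mat n lab G)"

definition all_ones_mat :: "nat \<Rightarrow> real mat" where
  "all_ones_mat n = mat n n (\<lambda>_. 1)"

definition switching :: "'a pair_pre_digraph \<Rightarrow> 'a set \<Rightarrow> 'a pair_pre_digraph" where
  "switching T X = \<lparr> pverts = pverts T,
     parcs = {(u, v). if u \<in> X \<longleftrightarrow> v \<in> X then (u, v) \<in> parcs T else (v, u) \<in> parcs T} \<rparr>"

definition switching_equivalent :: "'a pair_pre_digraph \<Rightarrow> 'a pair_pre_digraph \<Rightarrow> bool" where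
  "switching_equivalent T T' \<longleftrightarrow> (\<exists>X\<subseteq>pverts T. switching T X = T')"

definition doubly_regular :: "('a, 'b) pre_digraph \<Rightarrow> bool" where
  "doubly_regular G \<longleftrightarrow>
     (\<exists>h. \<forall>i\<in>verts G. \<forall>j\<in>verts G. i \<noteq> j \<longrightarrow>
        card {k \<in> verts G. i \<rightarrow>\<^bsub>G\<^esub> k \<and> j \<rightarrow>\<^bsub>G\<^esub> k} = h)"

end

theory Submission
  imports Defs
begin

text \<open>
  Let \<open>S = (s i j)\<close> be the Seidel matrix of a tournament on \<open>n\<close> vertices and let
  \<open>m i j = (\<Sum>k. s i k * s j k)\<close>; since \<open>S\<close> is skew, \<open>m\<close> is the matrix \<open>-S\<^sup>2\<close>. All three
  assertions are statements about the off-diagonal entries of \<open>m\<close>.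

  Diamonds. Expanding \<open>(m i j)\<^sup>2\<close> and summing over \<open>i \<noteq> j\<close> gives \<open>n(n-1)(n-2)\<close> plus a sum of
  products of \<open>S\<close> along 4-cycles. The three 4-cycles on a 4-set of vertices contribute \<open>-3\<close>
  in total if the set induces a diamond and \<open>1\<close> otherwise
  (\<open>four_cycle_sum_diamond\<close>, \<open>four_cycle_sum_not_diamond\<close>). Hence, with \<open>\<delta>\<close> diamonds,
  \<open>\<Sum>\<^sub>i\<^sub>\<noteq>\<^sub>j (m i j)\<^sup>2 = n(n-1)(n-2) + 8 (n choose 4) - 32 \<delta>\<close>. For odd \<open>n\<close> each off-diagonal
  \<open>m i j\<close> is a sum of \<open>n-2\<close> signs, hence odd, so the left-hand side is at least \<open>n(n-1)\<close>.
  The prescribed number of diamonds is exactly the value of \<open>\<delta>\<close> for which this bound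
  is attained, that is, for which every off-diagonal entry is \<open>\<plusminus>1\<close>
  (\<open>diamond_count_iff_row_prods_pm1\<close>).

  Signs. For \<open>n mod 4 = 3\<close> a congruence modulo 4 shows
  \<open>m i j + m j k + m k i = 1 (mod 4)\<close> for distinct \<open>i, j, k\<close>. If these entries are \<open>\<plusminus>1\<close>,
  their product is therefore \<open>-1\<close>, and reading off one row of \<open>m\<close> produces signs \<open>d\<close> with
  \<open>d i * d j * m i j = -1\<close> for all \<open>i \<noteq> j\<close> (\<open>row_prods_pm1_iff_switchable\<close>). With \<open>D\<close> the
  diagonal matrix of \<open>d\<close>, this says \<open>D S\<^sup>2 D + n I = J\<close> (\<open>signed_seidel_square_iff\<close>).

  Switching. Reversing the arcs between \<open>{u. d u = -1}\<close> and its complement replaces \<open>S\<close> by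
  \<open>D S D\<close> and hence \<open>m i j\<close> by \<open>d i * d j * m i j\<close>. A tournament on at least three vertices is doubly
  regular if and only if
  all its off-diagonal row products are \<open>-1\<close>
  (\<open>constant_common_out_iff_row_prods\<close>), so the existence of \<open>d\<close> is also the third assertion
  (\<open>switching_equivalent_doubly_regular_iff\<close>).
\<close>

section \<open>Four-element subsets\<close>

text \<open>
  An ordered quadruple of distinct elements is an enumeration of the 4-set of its entries.
  This is what turns a sum over pairs of rows and pairs of columns into a count of
  4-vertex subtournaments.
\<close>

lemma sum_quadruples_eq_sum_four_subsets:
  fixes f :: "'a \<Rightarrow> 'a \<Rightarrow> 'a \<Rightarrow> 'a \<Rightarrow> 'b::comm_monoid_add"
  assumes "finite V"
  shows "(\<Sum>i\<in>V. \<Sum>j\<in>V - {i}. \<Sum>k\<in>V - {i, j}. \<Sum>l\<in>V - {i, j, k}. f i j k l)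
    = (\<Sum>X | X \<subseteq> V \<and> card X = 4.
         \<Sum>i\<in>X. \<Sum>j\<in>X - {i}. \<Sum>k\<in>X - {i, j}. \<Sum>l\<in>X - {i, j, k}. f i j k l)"
proof -
  define Q where "Q X = (SIGMA i:X. SIGMA j:X - {i}. SIGMA k:X - {i, j}. X - {i, j, k})"
    for X :: "'a set"
  define F where "F = (\<lambda>(i, j, k, l). f i j k l)"
  define supp where "supp = (\<lambda>(i, j, k, l). {i, j, k, l :: 'a})"
  have Q_sum: "(\<Sum>i\<in>X. \<Sum>j\<in>X - {i}. \<Sum>k\<in>X - {i, j}. \<Sum>l\<in>X - {i, j, k}. f i j k l) = sum F (Q X)"
    if "finite X" for X
    using that unfolding Q_def F_def by (simp add: sum.Sigma split_def)
  have fibre: "{q \<in> Q V. supp q = X} = Q X" if "X \<subseteq> V" "card X = 4" for X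
  proof
    show "{q \<in> Q V. supp q = X} \<subseteq> Q X"
      by (auto simp: Q_def supp_def)
    have "supp q = X" if "q \<in> Q X" for q
    proof (rule card_subset_eq)
      obtain i j k l where q: "q = (i, j, k, l)" by (metis prod_cases4)
      then have "distinct [i, j, k, l]" using that by (auto simp: Q_def)
      show "finite X" using \<open>card X = 4\<close> by (simp add: card_ge_0_finite)
      have "card (set [i, j, k, l]) = 4" using \<open>distinct [i, j, k, l]\<close> by (simp only: distinct_card) simp
      then show "card (supp q) = card X"
        using \<open>card X = 4\<close> by (simp add: supp_def q)
      show "supp q \<subseteq> X"
        using that by (auto simp: Q_def supp_def)
    qed
    then show "Q X \<subseteq> {q \<in> Q V. supp q = X}"
      using \<open>X \<subseteq> V\<close> by (auto simp: Q_def)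
  qed
  have "sum F (Q V) = (\<Sum>X | X \<subseteq> V \<and> card X = 4. sum F {q \<in> Q V. supp q = X})"
    by (rule sum.group[symmetric])
       (use assms in \<open>auto simp: Q_def supp_def card_insert_if\<close>)
  also have "\<dots> = (\<Sum>X | X \<subseteq> V \<and> card X = 4. sum F (Q X))"
    by (rule sum.cong) (simp_all add: fibre)
  also have "\<dots> = (\<Sum>X | X \<subseteq> V \<and> card X = 4.
      \<Sum>i\<in>X. \<Sum>j\<in>X - {i}. \<Sum>k\<in>X - {i, j}. \<Sum>l\<in>X - {i, j, k}. f i j k l)"
    using finite_subset[OF _ assms] by (intro sum.cong refl Q_sum[symmetric]) auto
  finally show ?thesis
    by (simp only: Q_sum[OF assms])
qed

section \<open>Skew sign matrices and diamonds\<close>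

text \<open>
  The Seidel matrix of a tournament, indexed by the vertices themselves instead of by a
  labelling, and with integer entries so that congruences modulo 4 make sense. Switching
  acts on such matrices by multiplication with signs.
\<close>

locale skew_signs =
  fixes V :: "'a set" and s :: "'a \<Rightarrow> 'a \<Rightarrow> int"
  assumes finite_V: "finite V"
    and skew: "i \<in> V \<Longrightarrow> j \<in> V \<Longrightarrow> s j i = - s i j"
    and sign: "i \<in> V \<Longrightarrow> j \<in> V \<Longrightarrow> i \<noteq> j \<Longrightarrow> s i j = 1 \<or> s i j = -1"
begin

text \<open>For skew \<open>s\<close> this is the matrix \<open>s s\<^sup>t = -s\<^sup>2\<close>.\<close>

definition row_prod :: "'a \<Rightarrow> 'a \<Rightarrow> int" where
  "row_prod i j = (\<Sum>k\<in>V. s i k * s j k)"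

lemma loop_zero: "i \<in> V \<Longrightarrow> s i i = 0"
  using skew[of i i] by simp

lemma row_prod_commute: "row_prod i j = row_prod j i"
  by (simp add: row_prod_def mult.commute)

lemma row_prod_off_diagonal:
  assumes "i \<in> V" "j \<in> V"
  shows "row_prod i j = (\<Sum>k\<in>V - {i, j}. s i k * s j k)"
  unfolding row_prod_def
  by (rule sum.mono_neutral_right) (use assms finite_V in \<open>auto simp: loop_zero\<close>)

text \<open>Off the diagonal a row product has \<open>card V - 2\<close> nonzero terms, all of them \<open>\<plusminus>1\<close>, so it
  is odd, and in particular nonzero.\<close>

lemma row_prod_square_ge_1:
  assumes "odd (card V)" "i \<in> V" "j \<in> V" "i \<noteq> j"
  shows "(row_prod i j)\<^sup>2 \<ge> 1"
proof -
  have "even (\<Sum>k\<in>V - {i, j}. s i k * s j k - 1)"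
  proof (rule dvd_sum)
    fix k assume "k \<in> V - {i, j}"
    then have "s i k = 1 \<or> s i k = -1" "s j k = 1 \<or> s j k = -1"
      using sign assms by auto
    then show "even (s i k * s j k - 1)" by auto
  qed
  then have "even (row_prod i j - int (card (V - {i, j})))"
    using assms by (simp add: row_prod_off_diagonal sum_subtractf)
  moreover have "odd (card (V - {i, j}))"
    using assms finite_V card_mono[of V "{i, j}"] by (simp add: card_Diff_subset)
  ultimately have "row_prod i j \<noteq> 0"
    by (auto simp: even_diff_iff)
  then have "0 < (row_prod i j)\<^sup>2" by simp
  then show ?thesis by linarith
qed

text \<open>
  The product of the entries of \<open>s\<close> along the 4-cycle \<open>i, k, j, l\<close>, in which \<open>{i, j}\<close> and
  \<open>{k, l}\<close> are the pairs of opposite vertices. A 4-cycle has an even number of edges, so the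
  product does not depend on the direction in which the cycle is traversed.
\<close>

definition four_cycle_prod :: "'a \<Rightarrow> 'a \<Rightarrow> 'a \<Rightarrow> 'a \<Rightarrow> int" where
  "four_cycle_prod i j k l = s i k * s j k * s i l * s j l"

text \<open>
  The three 4-cycles on \<open>{a, b, c, d}\<close> correspond to its three partitions into opposite pairs.
  The determinant of \<open>s\<close> restricted to \<open>{a, b, c, d}\<close> is \<open>3\<close> minus twice this sum, so the values
  \<open>-3\<close> and \<open>1\<close> below are the classical determinants \<open>9\<close> and \<open>1\<close>.
\<close>

definition four_cycle_sum :: "'a \<Rightarrow> 'a \<Rightarrow> 'a \<Rightarrow> 'a \<Rightarrow> int" where
  "four_cycle_sum a b c d =
     four_cycle_prod a b c d + four_cycle_prod a c b d + four_cycle_prod a d b c"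

definition diamond_at :: "'a \<Rightarrow> 'a \<Rightarrow> 'a \<Rightarrow> 'a \<Rightarrow> bool" where
  "diamond_at v a b c \<longleftrightarrow> s a b = 1 \<and> s b c = 1 \<and> s c a = 1 \<and>
     ((\<forall>x\<in>{a, b, c}. s v x = 1) \<or> (\<forall>x\<in>{a, b, c}. s x v = 1))"

definition diamond_sets :: "'a set set" where
  "diamond_sets = {X. X \<subseteq> V \<and> card X = 4 \<and> (\<exists>v a b c. X = {v, a, b, c} \<and> diamond_at v a b c)}"

lemma four_cycle_sum_diamond:
  assumes "{v, a, b, c} \<subseteq> V" "diamond_at v a b c"
  shows "four_cycle_sum v a b c = -3"
proof -
  have "s b a = -1" "s c b = -1" "s a c = -1"
    using assms skew[of a b] skew[of b c] skew[of c a] by (auto simp: diamond_at_def)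
  moreover have "s a v = - s v a" "s b v = - s v b" "s c v = - s v c"
    using assms by (auto intro: skew)
  ultimately show ?thesis
    using assms by (auto simp: four_cycle_sum_def four_cycle_prod_def diamond_at_def)
qed

text \<open>
  Let \<open>u, v, w\<close> be the products of \<open>s\<close> over the three perfect matchings of \<open>{a, b, c, d}\<close>, with
  \<open>b, c, d\<close> taken in cyclic order. A 4-cycle is the union of two perfect matchings, so the sum
  is \<open>-(u v + v w + w u)\<close>, which is \<open>1\<close> for signs \<open>u, v, w\<close> that are not all equal. If they are
  equal, the arcs at \<open>a\<close> and the value of \<open>u\<close> determine all other arcs, and each of the 16
  possibilities is a diamond.
\<close>

lemma four_cycle_sum_not_diamond:
  assumes "{a, b, c, d} \<subseteq> V" "distinct [a, b, c, d]"
    and "\<not> (\<exists>v x y z. {a, b, c, d} = {v, x, y, z} \<and> diamond_at v x y z)"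
  shows "four_cycle_sum a b c d = 1"
proof -
  \<comment> \<open>A diamond is given by its centre and one of the two directions of the remaining 3-cycle.\<close>
  have perms: "{a, b, c, d} = {a, d, c, b}" "{a, b, c, d} = {b, a, c, d}" "{a, b, c, d} = {b, d, c, a}"
    "{a, b, c, d} = {c, a, b, d}" "{a, b, c, d} = {c, d, b, a}" "{a, b, c, d} = {d, a, b, c}"
    "{a, b, c, d} = {d, c, b, a}"
    by auto
  have no: "\<not> diamond_at a b c d" "\<not> diamond_at a d c b" "\<not> diamond_at b a c d" "\<not> diamond_at b d c a"
    "\<not> diamond_at c a b d" "\<not> diamond_at c d b a" "\<not> diamond_at d a b c" "\<not> diamond_at d c b a"
    using assms(3) perms by blast+
  have rev: "s b a = - s a b" "s c a = - s a c" "s d a = - s a d"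
    "s c b = - s b c" "s d c = - s c d" "s b d = - s d b"
    using assms(1) by (auto intro: skew)
  have pm: "s a b = 1 \<or> s a b = -1" "s a c = 1 \<or> s a c = -1" "s a d = 1 \<or> s a d = -1"
    "s b c = 1 \<or> s b c = -1" "s c d = 1 \<or> s c d = -1" "s d b = 1 \<or> s d b = -1"
    by (rule sign; use assms(1,2) in force)+
  define u v w where "u = s a d * s b c" and "v = s a b * s c d" and "w = s a c * s d b"
  have pm': "u = 1 \<or> u = -1" "v = 1 \<or> v = -1" "w = 1 \<or> w = -1"
    using pm unfolding u_def v_def w_def by auto
  have "four_cycle_sum a b c d = - (u * v + v * w + w * u)"
    unfolding four_cycle_sum_def four_cycle_prod_def u_def v_def w_def rev by simp
  moreover have "\<not> (v = u \<and> w = u)"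
  proof
    assume "v = u \<and> w = u"
    then have "s b c = u * s a d" "s c d = u * s a b" "s d b = u * s a c"
      using pm unfolding u_def v_def w_def by auto
    then show False
      using pm(1-3) pm'(1) no
      by (elim disjE) (simp_all add: diamond_at_def rev)
  qed
  ultimately show ?thesis
    using pm' by auto
qed

text \<open>Each of the three 4-cycles arises from 8 of the 24 orderings: either pair of opposite
  vertices may come first, and each pair may be listed in two ways.\<close>

lemma four_cycle_prod_sum_over_orderings:
  assumes "{a, b, c, d} \<subseteq> V" "distinct [a, b, c, d]" "X = {a, b, c, d}"
  shows "(\<Sum>i\<in>X. \<Sum>j\<in>X - {i}. \<Sum>k\<in>X - {i, j}. \<Sum>l\<in>X - {i, j, k}. four_cycle_prod i j k l)
    = 8 * four_cycle_sum a b c d"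
proof -
  have rev: "s b a = - s a b" "s c a = - s a c" "s d a = - s a d"
    "s c b = - s b c" "s d b = - s b d" "s d c = - s c d"
    using assms(1) by (auto intro: skew)
  have ne: "a \<noteq> b" "a \<noteq> c" "a \<noteq> d" "b \<noteq> c" "b \<noteq> d" "c \<noteq> d"
    using assms(2) by auto
  show ?thesis
    unfolding assms(3) four_cycle_sum_def four_cycle_prod_def
    by (simp add: insert_Diff_if ne ne[symmetric] rev)
qed

text \<open>A 4-set contributes \<open>8 * 1\<close>, or \<open>8 * (-3) = 8 - 32\<close> if it induces a diamond.\<close>

lemma sum_four_cycle_prod:
  "(\<Sum>i\<in>V. \<Sum>j\<in>V - {i}. \<Sum>k\<in>V - {i, j}. \<Sum>l\<in>V - {i, j, k}. four_cycle_prod i j k l)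
    = 8 * int (card V choose 4) - 32 * int (card diamond_sets)"
proof -
  let ?F = "{X. X \<subseteq> V \<and> card X = 4}"
  have fin: "finite ?F" using finite_V by simp
  have sub: "diamond_sets \<subseteq> ?F" by (auto simp: diamond_sets_def)
  have val: "(\<Sum>i\<in>X. \<Sum>j\<in>X - {i}. \<Sum>k\<in>X - {i, j}. \<Sum>l\<in>X - {i, j, k}. four_cycle_prod i j k l)
      = 8 - (if X \<in> diamond_sets then 32 else 0)" if "X \<in> ?F" for X
  proof (cases "X \<in> diamond_sets")
    case True
    then obtain v a b c where X: "X = {v, a, b, c}" and "diamond_at v a b c"
      by (auto simp: diamond_sets_def)
    moreover have "distinct [v, a, b, c]"
      using that unfolding X by (auto simp: card_insert_if split: if_splits)
    ultimately show ?thesis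
      using True that four_cycle_prod_sum_over_orderings[OF _ _ X] four_cycle_sum_diamond
      by simp
  next
    case False
    have "finite X" using that finite_subset[OF _ finite_V] by simp
    obtain xs where xs: "set xs = X" "distinct xs"
      using finite_distinct_list[OF \<open>finite X\<close>] by blast
    then have "length xs = 4" using that distinct_card by fastforce
    then obtain a b c d where "xs = [a, b, c, d]"
      by (auto simp: numeral_eq_Suc length_Suc_conv)
    then have X: "X = {a, b, c, d}" and dist: "distinct [a, b, c, d]" using xs by auto
    have V: "{a, b, c, d} \<subseteq> V" using that X by auto
    have "four_cycle_sum a b c d = 1"
      using False that X by (intro four_cycle_sum_not_diamond[OF V dist]) (auto simp: diamond_sets_def)
    then show ?thesis
      using False four_cycle_prod_sum_over_orderings[OF V dist X] by simp
  qed
  have "(\<Sum>X\<in>?F. 8 - (if X \<in> diamond_sets then 32 else 0 :: int))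
      = 8 * int (card ?F) - 32 * int (card (?F \<inter> diamond_sets))"
    by (simp add: sum_subtractf sum.inter_restrict[OF fin, symmetric])
  also have "?F \<inter> diamond_sets = diamond_sets" using sub by auto
  also have "card ?F = card V choose 4"
    using n_subsets[OF finite_V] by simp
  finally show ?thesis
    unfolding sum_quadruples_eq_sum_four_subsets[OF finite_V] 
    using sum.cong[OF refl val, where A = ?F] by (simp only:)
qed

text \<open>Squaring a row product gives a sum over two columns \<open>k\<close> and \<open>l\<close>. The terms with
  \<open>k = l\<close> are all \<open>1\<close>, and the others run over the 4-cycles in which \<open>i\<close> and \<open>j\<close> are opposite.\<close>

lemma row_prod_square:
  assumes "i \<in> V" "j \<in> V" "i \<noteq> j"
  shows "(row_prod i j)\<^sup>2 = int (card V) - 2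
    + (\<Sum>k\<in>V - {i, j}. \<Sum>l\<in>V - {i, j, k}. four_cycle_prod i j k l)"
proof -
  let ?g = "\<lambda>k. s i k * s j k"
  have "(row_prod i j)\<^sup>2 = (\<Sum>k\<in>V - {i, j}. \<Sum>l\<in>V - {i, j}. ?g k * ?g l)"
    using assms by (simp add: row_prod_off_diagonal power2_eq_square sum_product)
  also have "\<dots> = (\<Sum>k\<in>V - {i, j}. 1 + (\<Sum>l\<in>V - {i, j, k}. four_cycle_prod i j k l))"
  proof (rule sum.cong[OF refl])
    fix k assume k: "k \<in> V - {i, j}"
    then have "?g k * ?g k = 1"
      using assms sign[of i k] sign[of j k] by auto
    moreover have "V - {i, j} - {k} = V - {i, j, k}" by auto
    ultimately show "(\<Sum>l\<in>V - {i, j}. ?g k * ?g l)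
        = 1 + (\<Sum>l\<in>V - {i, j, k}. four_cycle_prod i j k l)"
      using k finite_V
      by (simp add: sum.remove[of _ k] four_cycle_prod_def mult_ac)
  qed
  also have "\<dots> = int (card (V - {i, j})) + (\<Sum>k\<in>V - {i, j}. \<Sum>l\<in>V - {i, j, k}. four_cycle_prod i j k l)"
    by (simp add: sum.distrib)
  also have "int (card (V - {i, j})) = int (card V) - 2"
    using assms finite_V card_mono[of V "{i, j}"] by (simp add: card_Diff_subset of_nat_diff)
  finally show ?thesis .
qed

lemma card_minus_vertex: "i \<in> V \<Longrightarrow> int (card (V - {i})) = int (card V) - 1"
  using card_Suc_Diff1[OF finite_V, of i] by linarith

lemma sum_row_prod_squares:
  "(\<Sum>i\<in>V. \<Sum>j\<in>V - {i}. (row_prod i j)\<^sup>2)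
    = int (card V) * (int (card V) - 1) * (int (card V) - 2)
      + 8 * int (card V choose 4) - 32 * int (card diamond_sets)"
proof -
  have "(\<Sum>i\<in>V. \<Sum>j\<in>V - {i}. (row_prod i j)\<^sup>2)
    = (\<Sum>i\<in>V. \<Sum>j\<in>V - {i}. int (card V) - 2
        + (\<Sum>k\<in>V - {i, j}. \<Sum>l\<in>V - {i, j, k}. four_cycle_prod i j k l))"
    by (intro sum.cong refl) (auto simp: row_prod_square)
  also have "\<dots> = (\<Sum>i\<in>V. (int (card V) - 1) * (int (card V) - 2))
      + (8 * int (card V choose 4) - 32 * int (card diamond_sets))"
    by (simp add: sum.distrib sum_four_cycle_prod card_minus_vertex del: card_Diff_insert card_Diff_singleton cong: sum.cong)
  finally show ?thesis by simp
qed

text \<open>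
  By \<open>sum_row_prod_squares\<close> the squares of the off-diagonal entries exceed \<open>1\<close> by
  \<open>n(n-1)(n-3) + 8 (n choose 4) - 32 \<delta>\<close> in total, where \<open>\<delta>\<close> is the number of diamonds. No single
  excess is negative when \<open>n\<close> is odd, so the total vanishes only if all of them do, and the
  given number is the value of \<open>\<delta>\<close> at which the total vanishes.
\<close>

lemma diamond_count_iff_row_prods_pm1:
  assumes "odd (card V)"
  shows "real (card diamond_sets)
      = 1 / 96 * real (card V) * (real (card V) - 1) * (real (card V) - 3) * (real (card V) + 1)
    \<longleftrightarrow> (\<forall>i\<in>V. \<forall>j\<in>V. i \<noteq> j \<longrightarrow> (row_prod i j)\<^sup>2 = 1)"
proof -
  let ?n = "real (card V)"
  have excess: "(\<Sum>i\<in>V. \<Sum>j\<in>V - {i}. (row_prod i j)\<^sup>2 - 1)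
      = int (card V) * (int (card V) - 1) * (int (card V) - 3)
        + 8 * int (card V choose 4) - 32 * int (card diamond_sets)" (is "?E = _")
  proof -
    have "?E = (\<Sum>i\<in>V. \<Sum>j\<in>V - {i}. (row_prod i j)\<^sup>2) - int (card V) * (int (card V) - 1)"
      by (simp add: sum_subtractf card_minus_vertex del: card_Diff_insert card_Diff_singleton cong: sum.cong)
    then show ?thesis by (simp add: sum_row_prod_squares algebra_simps)
  qed
  have choose: "real (card V choose 4) = ?n * (?n - 1) * (?n - 2) * (?n - 3) / 24"
    by (simp add: binomial_gbinomial gbinomial_prod_rev fact_numeral numeral_eq_Suc)
  have "real_of_int ?E = ?n * (?n - 1) * (?n - 3)
        + 8 * real (card V choose 4) - 32 * real (card diamond_sets)"
    unfolding excess by simp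
  also have "\<dots> = 32 * (1 / 96 * ?n * (?n - 1) * (?n - 3) * (?n + 1) - real (card diamond_sets))"
    unfolding choose by (simp add: field_simps)
  finally have scaled: "real_of_int ?E
    = 32 * (1 / 96 * ?n * (?n - 1) * (?n - 3) * (?n + 1) - real (card diamond_sets))" .
  have nonneg: "0 \<le> (row_prod i j)\<^sup>2 - 1" if "i \<in> V" "j \<in> V - {i}" for i j
    using that row_prod_square_ge_1[OF assms, of i j] by auto
  have "real (card diamond_sets) = 1 / 96 * ?n * (?n - 1) * (?n - 3) * (?n + 1)
      \<longleftrightarrow> real_of_int ?E = 0"
    unfolding scaled by (metis mult_eq_0_iff right_minus_eq zero_neq_numeral)
  also have "\<dots> \<longleftrightarrow> ?E = 0"
    by (rule of_int_eq_0_iff)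
  also have "\<dots> \<longleftrightarrow> (\<forall>i\<in>V. (\<Sum>j\<in>V - {i}. (row_prod i j)\<^sup>2 - 1) = 0)"
    using finite_V nonneg by (intro sum_nonneg_eq_0_iff sum_nonneg)
  also have "\<dots> \<longleftrightarrow> (\<forall>i\<in>V. \<forall>j\<in>V - {i}. (row_prod i j)\<^sup>2 - 1 = 0)"
    using finite_V nonneg by (intro ball_cong refl sum_nonneg_eq_0_iff) auto
  finally show ?thesis by auto
qed

lemma row_prod_self:
  assumes "i \<in> V"
  shows "row_prod i i = int (card V) - 1"
proof -
  have "row_prod i i = (\<Sum>k\<in>V - {i}. s i k * s i k)"
    using row_prod_off_diagonal[OF assms assms] by simp
  also have "\<dots> = (\<Sum>k\<in>V - {i}. 1)"
    using sign assms by (intro sum.cong refl) fastforce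
  finally show ?thesis using card_minus_vertex[OF assms] by simp
qed

section \<open>Row products equal to 1 or -1\<close>

text \<open>
  Column \<open>l\<close> contributes \<open>x y + y z + z x\<close>, where \<open>x, y, z\<close> are the entries of the three rows.
  For signs this is \<open>3\<close> or \<open>-1\<close>, hence \<open>-1\<close> modulo 4. The number \<open>card V - 3\<close> of columns other
  than \<open>i, j, k\<close> is divisible by 4, so together they contribute \<open>0\<close>. The columns \<open>i, j, k\<close> give
  minus an expression of the same form, in the signs of the three arcs, hence \<open>1\<close>.
\<close>

lemma row_prods_triangle_mod_4:
  assumes n: "card V mod 4 = 3" and V: "i \<in> V" "j \<in> V" "k \<in> V"
    and ne: "i \<noteq> j" "j \<noteq> k" "k \<noteq> i"
  shows "(row_prod i j + row_prod j k + row_prod k i) mod 4 = 1"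
proof -
  define t where "t l = s i l * s j l + s j l * s k l + s k l * s i l" for l
  have "4 dvd (\<Sum>l\<in>V - {i, j, k}. t l + 1)"
  proof (rule dvd_sum)
    fix l assume "l \<in> V - {i, j, k}"
    then have "s i l = 1 \<or> s i l = -1" "s j l = 1 \<or> s j l = -1" "s k l = 1 \<or> s k l = -1"
      using sign V by auto
    then show "4 dvd t l + 1" by (auto simp: t_def)
  qed
  moreover have "int (card (V - {i, j, k})) = int (card V) - 3"
    using V ne finite_V card_mono[of V "{i, j, k}"] by (simp add: card_Diff_subset of_nat_diff)
  moreover have "4 dvd int (card V) - 3"
    using n by presburger
  ultimately have rest: "4 dvd sum t (V - {i, j, k})"
    by (simp add: sum.distrib dvd_add_left_iff)
  have "s i j = 1 \<or> s i j = -1" "s j k = 1 \<or> s j k = -1" "s k i = 1 \<or> s k i = -1"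
    by (rule sign; use V ne in simp)+
  moreover have "s j i = - s i j" "s k j = - s j k" "s i k = - s k i"
    using V by (auto intro: skew)
  ultimately have corner: "t i + t j + t k = 1 \<or> t i + t j + t k = -3"
    using V by (auto simp: t_def loop_zero)
  have "row_prod i j + row_prod j k + row_prod k i = sum t V"
    by (simp add: row_prod_def t_def sum.distrib)
  also have "\<dots> = sum t (V - {i, j, k}) + (t i + t j + t k)"
    using V ne finite_V sum.subset_diff[of "{i, j, k}" V t] by (simp add: ac_simps)
  finally have "row_prod i j + row_prod j k + row_prod k i
      = sum t (V - {i, j, k}) + (t i + t j + t k)" .
  moreover obtain q where "sum t (V - {i, j, k}) = 4 * q"
    using rest by (rule dvdE)
  ultimately show ?thesis
    using corner by presburger
qed

text \<open>
  Three signs whose sum is \<open>1\<close> modulo 4 have product \<open>-1\<close>. Applied to the triangles through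
  a fixed vertex \<open>r\<close>, this determines every entry from row \<open>r\<close>:
  \<open>row_prod i j = - row_prod r i * row_prod r j\<close>. So up to sign, row \<open>r\<close> itself serves as \<open>d\<close>.
\<close>

lemma row_prods_pm1_iff_switchable:
  assumes n: "card V mod 4 = 3"
  shows "(\<forall>i\<in>V. \<forall>j\<in>V. i \<noteq> j \<longrightarrow> (row_prod i j)\<^sup>2 = 1) \<longleftrightarrow>
    (\<exists>d. (\<forall>i\<in>V. d i = 1 \<or> d i = -1) \<and>
       (\<forall>i\<in>V. \<forall>j\<in>V. i \<noteq> j \<longrightarrow> d i * d j * row_prod i j = -1))" (is "?L \<longleftrightarrow> ?R")
proof
  assume ?L
  then have pm1: "row_prod i j = 1 \<or> row_prod i j = -1" if "i \<in> V" "j \<in> V" "i \<noteq> j" for i j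
    using that by (simp add: power2_eq_1_iff)
  have "V \<noteq> {}" using n by auto
  then obtain r where r: "r \<in> V" by auto
  define d where "d i = (if i = r then 1 else - row_prod r i)" for i
  have d: "d i = 1 \<or> d i = -1" if "i \<in> V" for i
    using pm1[OF r that] by (auto simp: d_def)
  have "d i * d j * row_prod i j = -1" if V: "i \<in> V" "j \<in> V" and ne: "i \<noteq> j" for i j
  proof (cases "i = r \<or> j = r")
    case True
    then show ?thesis
      using pm1[OF V ne] ne by (auto simp: d_def row_prod_commute)
  next
    case False
    have "(row_prod r i + row_prod i j + row_prod j r) mod 4 = 1"
      using False r V ne by (intro row_prods_triangle_mod_4[OF n]) auto
    moreover have "row_prod r i = 1 \<or> row_prod r i = -1" "row_prod j r = 1 \<or> row_prod j r = -1"
      using pm1 False r V by auto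
    ultimately have "row_prod r i * row_prod j r * row_prod i j = -1"
      using pm1[OF V ne] by auto
    then show ?thesis
      using False by (simp add: d_def row_prod_commute[of j r])
  qed
  then show ?R using d by blast
next
  assume ?R
  then obtain d where d: "\<forall>i\<in>V. d i = 1 \<or> d i = -1"
    and dd: "\<forall>i\<in>V. \<forall>j\<in>V. i \<noteq> j \<longrightarrow> d i * d j * row_prod i j = -1"
    by blast
  show ?L
  proof (intro ballI impI)
    fix i j assume "i \<in> V" "j \<in> V" "i \<noteq> j"
    then have "d i = 1 \<or> d i = -1" "d j = 1 \<or> d j = -1" "d i * d j * row_prod i j = -1"
      using d dd by auto
    then show "(row_prod i j)\<^sup>2 = 1"
      by (auto simp: power2_eq_1_iff)
  qed
qed

lemma skew_signs_switch:
  assumes "\<And>i. i \<in> V \<Longrightarrow> d i = 1 \<or> d i = -1"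
  shows "skew_signs V (\<lambda>i j. d i * d j * s i j)"
proof
  fix i j assume V: "i \<in> V" "j \<in> V"
  show "d j * d i * s j i = - (d i * d j * s i j)"
    using skew[OF V] by simp
  show "d i * d j * s i j = 1 \<or> d i * d j * s i j = -1" if "i \<noteq> j"
    using assms[OF V(1)] assms[OF V(2)] sign[OF V that] by auto
qed (rule finite_V)

lemma row_prod_switch:
  assumes d: "\<And>i. i \<in> V \<Longrightarrow> d i = 1 \<or> d i = -1"
  shows "skew_signs.row_prod V (\<lambda>i j. d i * d j * s i j) i j = d i * d j * row_prod i j"
proof -
  have "skew_signs.row_prod V (\<lambda>i j. d i * d j * s i j) i j
      = (\<Sum>k\<in>V. (d i * d k * s i k) * (d j * d k * s j k))"
    using d by (intro skew_signs.row_prod_def skew_signs_switch)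
  also have "\<dots> = (\<Sum>k\<in>V. d i * d j * (s i k * s j k))"
    using d by (intro sum.cong refl) fastforce
  finally show ?thesis
    by (simp add: row_prod_def sum_distrib_left)
qed

section \<open>Double regularity\<close>

definition outdeg :: "'a \<Rightarrow> nat" where
  "outdeg i = card {k \<in> V. s i k = 1}"

definition common_out :: "'a \<Rightarrow> 'a \<Rightarrow> nat" where
  "common_out i j = card {k \<in> V. s i k = 1 \<and> s j k = 1}"

abbreviation arc :: "'a \<Rightarrow> 'a \<Rightarrow> int" where
  "arc i j \<equiv> of_bool (s i j = 1)"

lemma outdeg_eq_sum: "int (outdeg i) = (\<Sum>k\<in>V. arc i k)"
  using finite_V by (simp add: outdeg_def Int_def)

lemma common_out_eq_sum: "int (common_out i j) = (\<Sum>k\<in>V. arc i k * arc j k)"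
  using finite_V by (simp add: common_out_def Int_def flip: of_bool_conj)

lemma arc_loop: "i \<in> V \<Longrightarrow> arc i i = 0"
  by (simp add: loop_zero)

lemma arc_add_reverse:
  assumes "i \<in> V" "j \<in> V" "i \<noteq> j"
  shows "arc i j + arc j i = 1"
  using sign[OF assms] skew[OF assms(1,2)] by auto

text \<open>
  Off the diagonal \<open>s i k = 2 * arc i k - 1\<close>, and the formula results from multiplying out.
  Using this expression also on the diagonal changes the terms \<open>k = i\<close> and \<open>k = j\<close> by
  \<open>1 - 2 * arc j i\<close> and \<open>1 - 2 * arc i j\<close>, and these cancel because exactly one of the two arcs
  is present.
\<close>

lemma row_prod_eq_common_out:
  assumes V: "i \<in> V" "j \<in> V" and ne: "i \<noteq> j"
  shows "row_prod i j = 4 * int (common_out i j) - 2 * int (outdeg i) - 2 * int (outdeg j) + int (card V)"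
proof -
  let ?f = "\<lambda>k. (2 * arc i k - 1) * (2 * arc j k - 1)"
  have "s i k * s j k = ?f k" if "k \<in> V - {i, j}" for k
    using that V sign[of i k] sign[of j k] by auto
  then have "(\<Sum>k\<in>V. s i k * s j k - ?f k) = (\<Sum>k\<in>{i, j}. s i k * s j k - ?f k)"
    using V finite_V by (intro sum.mono_neutral_right) auto
  also have "\<dots> = 0"
    using V ne arc_add_reverse[OF V ne] by (simp add: loop_zero)
  finally have "row_prod i j = (\<Sum>k\<in>V. ?f k)"
    by (simp add: row_prod_def sum_subtractf)
  also have "\<dots> = (\<Sum>k\<in>V. 4 * (arc i k * arc j k) - 2 * arc i k - 2 * arc j k + 1)"
    by (intro sum.cong refl) (simp only: of_bool_def split: if_split, simp)
  also have "\<dots> = 4 * (\<Sum>k\<in>V. arc i k * arc j k) - 2 * (\<Sum>k\<in>V. arc i k)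
      - 2 * (\<Sum>k\<in>V. arc j k) + int (card V)"
    by (simp only: sum.distrib sum_subtractf sum_distrib_left[symmetric]) simp
  finally show ?thesis
    by (simp only: outdeg_eq_sum common_out_eq_sum)
qed

lemma sum_outdeg: "2 * (\<Sum>i\<in>V. int (outdeg i)) = int (card V) * (int (card V) - 1)"
proof -
  have "2 * (\<Sum>i\<in>V. int (outdeg i)) = (\<Sum>i\<in>V. \<Sum>j\<in>V. arc i j) + (\<Sum>i\<in>V. \<Sum>j\<in>V. arc i j)"
    by (simp only: outdeg_eq_sum)
  also have "\<dots> = (\<Sum>i\<in>V. \<Sum>j\<in>V. arc i j) + (\<Sum>i\<in>V. \<Sum>j\<in>V. arc j i)"
    by (subst (2) sum.swap) (rule refl)
  also have "\<dots> = (\<Sum>i\<in>V. \<Sum>j\<in>V. arc i j + arc j i)"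
    by (simp only: sum.distrib)
  also have "\<dots> = (\<Sum>i\<in>V. \<Sum>j\<in>V. 1 - of_bool (i = j))"
    using arc_add_reverse by (intro sum.cong refl) (auto simp: loop_zero)
  also have "\<dots> = int (card V) * (int (card V) - 1)"
    using finite_V by (simp add: sum_subtractf of_bool_def algebra_simps)
  finally show ?thesis .
qed

text \<open>
  The out-neighbours of \<open>i\<close> induce a tournament in which every vertex dominates exactly \<open>h\<close>
  others, namely its common out-neighbours with \<open>i\<close>. With \<open>o\<close> vertices it has \<open>o h\<close> arcs, and
  also \<open>o (o - 1) / 2\<close> arcs, which leaves \<open>o = 0\<close> or \<open>o = 2 h + 1\<close>.
\<close>

lemma outdeg_of_constant_common_out:
  assumes h: "\<And>i j. i \<in> V \<Longrightarrow> j \<in> V \<Longrightarrow> i \<noteq> j \<Longrightarrow> common_out i j = h" and i: "i \<in> V"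
  shows "outdeg i = 0 \<or> outdeg i = 2 * h + 1"
proof -
  let ?o = "int (outdeg i)"
  \<comment> \<open>The number of arcs between out-neighbours of \<open>i\<close>.\<close>
  define t where "t = (\<Sum>j\<in>V. \<Sum>k\<in>V. arc i j * arc i k * arc j k)"
  have "t = (\<Sum>j\<in>V. arc i j * int (common_out i j))"
    unfolding t_def by (simp only: common_out_eq_sum sum_distrib_left mult.assoc)
  also have "\<dots> = (\<Sum>j\<in>V. arc i j * int h)"
    using h[OF i] i by (intro sum.cong refl) (metis arc_loop mult_zero_left)
  also have "\<dots> = int h * ?o"
    unfolding outdeg_eq_sum sum_distrib_left by (intro sum.cong refl mult.commute)
  finally have t1: "t = int h * ?o" .
  have "2 * t = t + (\<Sum>j\<in>V. \<Sum>k\<in>V. arc i k * arc i j * arc k j)"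
    unfolding t_def by (subst (2) sum.swap) simp
  also have "\<dots> = (\<Sum>j\<in>V. \<Sum>k\<in>V. arc i j * arc i k * (arc j k + arc k j))"
    unfolding t_def by (simp only: sum.distrib distrib_left ac_simps)
  also have "\<dots> = (\<Sum>j\<in>V. \<Sum>k\<in>V. arc i j * arc i k - (if j = k then arc i j else 0))"
    using arc_add_reverse by (intro sum.cong refl) (auto simp: loop_zero)
  also have "\<dots> = ?o * ?o - ?o"
    using finite_V by (simp only: sum_subtractf sum_product[symmetric] sum.delta outdeg_eq_sum) simp
  finally have "?o * (?o - 1 - 2 * int h) = 0"
    using t1 by (simp add: algebra_simps)
  then show ?thesis by auto
qed

text \<open>
  Suppose that all pairs have \<open>h\<close> common out-neighbours. A sink would force \<open>h = 0\<close>, hence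
  all out-degrees at most \<open>1\<close>, which leaves too few arcs for three or more vertices. So all
  out-degrees are \<open>2 h + 1\<close>, and counting arcs gives \<open>card V = 4 h + 3\<close>.

  Conversely, suppose that all off-diagonal row products are \<open>-1\<close>. Then every row of the
  matrix of row products sums to \<open>0\<close>. The sum of all its entries is the sum of the squared
  column sums of \<open>s\<close>, so the latter vanish and the tournament is regular.
  In both directions \<open>row_prod_eq_common_out\<close> translates between the two quantities.
\<close>

lemma constant_common_out_iff_row_prods:
  assumes n: "card V \<ge> 3"
  shows "(\<exists>h. \<forall>i\<in>V. \<forall>j\<in>V. i \<noteq> j \<longrightarrow> common_out i j = h) \<longleftrightarrow>
    (\<forall>i\<in>V. \<forall>j\<in>V. i \<noteq> j \<longrightarrow> row_prod i j = -1)" (is "?L \<longleftrightarrow> ?R")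
proof
  assume ?L
  then obtain h where h: "\<And>i j. i \<in> V \<Longrightarrow> j \<in> V \<Longrightarrow> i \<noteq> j \<Longrightarrow> common_out i j = h" by blast
  have deg: "outdeg i = 0 \<or> outdeg i = 2 * h + 1" if "i \<in> V" for i
    using h that by (rule outdeg_of_constant_common_out)
  have "outdeg i \<noteq> 0" if i: "i \<in> V" for i
  proof
    assume sink: "outdeg i = 0"
    have "card (V - {i}) \<noteq> 0"
      using n card_minus_vertex[OF i] by linarith
    then have "V - {i} \<noteq> {}" by (metis card.empty)
    then obtain j where j: "j \<in> V" "j \<noteq> i" by blast
    have "common_out i j \<le> outdeg i"
      unfolding common_out_def outdeg_def using finite_V by (intro card_mono) auto
    then have "h = 0" using h[OF i j(1)] j sink by simp
    then have "int (outdeg k) \<le> 1" if "k \<in> V" for k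
      using deg[OF that] by auto
    then have "(\<Sum>k\<in>V - {i}. int (outdeg k)) \<le> (\<Sum>k\<in>V - {i}. 1)"
      by (intro sum_mono) auto
    then have "(\<Sum>k\<in>V. int (outdeg k)) \<le> int (card V) - 1"
      using i finite_V sink card_minus_vertex[OF i] by (simp add: sum.remove[of V i])
    then have "int (card V) * (int (card V) - 1) \<le> 2 * (int (card V) - 1)"
      unfolding sum_outdeg[symmetric] by (rule mult_left_mono) simp
    then show False
      using mult_right_le_imp_le[of "int (card V)" "int (card V) - 1" 2] n by simp
  qed
  then have deg: "outdeg i = 2 * h + 1" if "i \<in> V" for i
    using deg that by blast
  then have "int (card V) * (int (card V) - 1) = int (card V) * (2 * (2 * int h + 1))"
    using sum_outdeg by (simp add: algebra_simps)
  then have "int (card V) = 4 * int h + 3"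
    using n by auto
  then show ?R
    using deg h by (simp add: row_prod_eq_common_out)
next
  assume R: ?R
  have regular: "2 * int (outdeg i) = int (card V) - 1" if i: "i \<in> V" for i
  proof -
    have "(\<Sum>k\<in>V. (\<Sum>j\<in>V. s j k)\<^sup>2) = (\<Sum>k\<in>V. \<Sum>j\<in>V. \<Sum>l\<in>V. s j k * s l k)"
      by (simp add: power2_eq_square sum_product)
    also have "\<dots> = (\<Sum>j\<in>V. \<Sum>k\<in>V. \<Sum>l\<in>V. s j k * s l k)"
      by (rule sum.swap)
    also have "\<dots> = (\<Sum>j\<in>V. \<Sum>l\<in>V. row_prod j l)"
      unfolding row_prod_def by (intro sum.cong refl sum.swap)
    also have "\<dots> = (\<Sum>j\<in>V. row_prod j j + (\<Sum>l\<in>V - {j}. row_prod j l))"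
      using finite_V by (intro sum.cong refl sum.remove)
    also have "\<dots> = (\<Sum>j\<in>V. 0)"
    proof (rule sum.cong[OF refl])
      fix j assume j: "j \<in> V"
      have "(\<Sum>l\<in>V - {j}. row_prod j l) = (\<Sum>l\<in>V - {j}. -1)"
        using R j by (intro sum.cong refl) auto
      then show "row_prod j j + (\<Sum>l\<in>V - {j}. row_prod j l) = 0"
        using row_prod_self[OF j] card_minus_vertex[OF j] by simp
    qed
    finally have "(\<Sum>k\<in>V. (\<Sum>j\<in>V. s j k)\<^sup>2) = 0" by simp
    then have "(\<Sum>j\<in>V. s j i) = 0"
      using finite_V i by (subst (asm) sum_nonneg_eq_0_iff) auto
    moreover have "(\<Sum>j\<in>V. s j i) = (\<Sum>j\<in>V. - s i j)"
      using i by (intro sum.cong refl skew)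
    ultimately have "0 = (\<Sum>j\<in>V. s i j)"
      by (simp add: sum_negf)
    also have "\<dots> = (\<Sum>j\<in>V. 2 * arc i j - 1 + of_bool (i = j))"
    proof (rule sum.cong[OF refl])
      fix j assume "j \<in> V"
      then show "s i j = 2 * arc i j - 1 + of_bool (i = j)"
        using i sign[of i j] by (cases "i = j") (auto simp: loop_zero)
    qed
    also have "\<dots> = 2 * int (outdeg i) - int (card V) + 1"
      using finite_V i
      by (simp only: sum.distrib sum_subtractf sum_distrib_left[symmetric] outdeg_eq_sum) simp
    finally show ?thesis by simp
  qed
  have "common_out i j = (card V - 3) div 4" if V: "i \<in> V" "j \<in> V" and ne: "i \<noteq> j" for i j
    using R row_prod_eq_common_out[OF V ne] regular[OF V(1)] regular[OF V(2)] V ne by auto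
  then show ?L by blast
qed

end

section \<open>Tournaments as sign matrices\<close>

definition arc_sign :: "'a pair_pre_digraph \<Rightarrow> 'a \<Rightarrow> 'a \<Rightarrow> int" where
  "arc_sign T u v = of_bool ((u, v) \<in> parcs T) - of_bool ((v, u) \<in> parcs T)"

lemma tournament_with_proj_iff:
  "tournament (with_proj T) \<longleftrightarrow>
    finite (pverts T) \<and> parcs T \<subseteq> pverts T \<times> pverts T \<and> asym (parcs T) \<and> total_on (pverts T) (parcs T)"
  (is "_ \<longleftrightarrow> ?R")
proof
  assume "tournament (with_proj T)"
  then interpret tournament "with_proj T" .
  have sub: "parcs T \<subseteq> pverts T \<times> pverts T"
    using tail_in_verts head_in_verts by auto
  have loop: "(u, u) \<notin> parcs T" for u
    using no_loops[of "(u, u)"] by auto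
  have "(v, u) \<notin> parcs T" if uv: "(u, v) \<in> parcs T" for u v
  proof -
    have "u \<in> pverts T" "v \<in> pverts T" "u \<noteq> v"
      using uv sub loop by auto
    then show ?thesis
      using one_orientation[of u v] uv by simp
  qed
  then have "asym (parcs T)" by (rule asymI)
  moreover have "total_on (pverts T) (parcs T)"
    using one_orientation by (intro total_onI) (metis with_proj_simps(1,3))
  ultimately show ?R
    using sub finite_verts by simp
next
  assume R: ?R
  then have sub: "parcs T \<subseteq> pverts T \<times> pverts T" and fin: "finite (parcs T)"
    by (auto intro: finite_subset)
  show "tournament (with_proj T)"
  proof
    show "tail (with_proj T) e \<in> verts (with_proj T)" "head (with_proj T) e \<in> verts (with_proj T)"
      if "e \<in> arcs (with_proj T)" for e
      using that sub by auto
    show "finite (verts (with_proj T))" "finite (arcs (with_proj T))"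
      using R fin by simp_all
    show "tail (with_proj T) e \<noteq> head (with_proj T) e" if "e \<in> arcs (with_proj T)" for e
      using that R by (cases e) (auto dest: asymD)
    show "e1 = e2" if "arc_to_ends (with_proj T) e1 = arc_to_ends (with_proj T) e2" for e1 e2
      using that by (simp add: arc_to_ends_def prod_eq_iff)
    show "u \<rightarrow>\<^bsub>with_proj T\<^esub> v \<longleftrightarrow> \<not> v \<rightarrow>\<^bsub>with_proj T\<^esub> u"
      if "u \<in> verts (with_proj T)" "v \<in> verts (with_proj T)" "u \<noteq> v" for u v
    proof -
      have "(u, v) \<in> parcs T \<or> (v, u) \<in> parcs T"
        using R that by (simp add: total_on_def)
      then show ?thesis
        using R asymD[of "parcs T"] by auto
    qed
  qed
qed

lemma skew_signs_arc_sign: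
  assumes "tournament (with_proj T)"
  shows "skew_signs (pverts T) (arc_sign T)"
proof
  show "finite (pverts T)"
    using assms by (simp add: tournament_with_proj_iff)
  show "arc_sign T v u = - arc_sign T u v" for u v
    by (simp add: arc_sign_def)
  show "arc_sign T u v = 1 \<or> arc_sign T u v = -1"
    if "u \<in> pverts T" "v \<in> pverts T" "u \<noteq> v" for u v
  proof -
    have "(u, v) \<in> parcs T \<or> (v, u) \<in> parcs T"
      using assms that by (simp add: tournament_with_proj_iff total_on_def)
    moreover have "\<not> ((u, v) \<in> parcs T \<and> (v, u) \<in> parcs T)"
      using assms by (auto simp: tournament_with_proj_iff dest: asymD)
    ultimately show ?thesis by (auto simp: arc_sign_def)
  qed
qed

lemma arc_sign_eq_1_iff:
  assumes "tournament (with_proj T)"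
  shows "arc_sign T u v = 1 \<longleftrightarrow> (u, v) \<in> parcs T"
proof -
  have "(v, u) \<notin> parcs T" if "(u, v) \<in> parcs T"
    using assms that by (auto simp: tournament_with_proj_iff dest: asymD)
  then show ?thesis by (auto simp: arc_sign_def)
qed

lemma arc_sign_switching:
  "arc_sign (switching T X) =
    (\<lambda>u v. (if u \<in> X then -1 else 1) * (if v \<in> X then -1 else 1) * arc_sign T u v)"
  by (intro ext) (auto simp: arc_sign_def switching_def)

lemma tournament_switching:
  assumes "tournament (with_proj T)"
  shows "tournament (with_proj (switching T X))"
proof -
  have R: "finite (pverts T)" "parcs T \<subseteq> pverts T \<times> pverts T" "asym (parcs T)"
    "total_on (pverts T) (parcs T)"
    using assms by (simp_all add: tournament_with_proj_iff)
  have "asym (parcs (switching T X))"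
    using asymD[OF R(3)] by (intro asymI) (auto simp: switching_def split: if_splits)
  moreover have "total_on (pverts T) (parcs (switching T X))"
    using R(4) by (auto simp: switching_def total_on_def)
  moreover have "parcs (switching T X) \<subseteq> pverts T \<times> pverts T"
    using R(2) by (auto simp: switching_def split: if_splits)
  ultimately show ?thesis
    using R(1) by (simp add: tournament_with_proj_iff switching_def)
qed

lemma tournament_induce_subgraph:
  assumes "tournament (with_proj T)" "X \<subseteq> pverts T"
  shows "tournament (with_proj T \<restriction> X)"
proof -
  let ?P = "{e \<in> parcs T. fst e \<in> X \<and> snd e \<in> X}"
  have R: "finite (pverts T)" "asym (parcs T)" "total_on (pverts T) (parcs T)"
    using assms by (simp_all add: tournament_with_proj_iff)
  have "asym ?P"
    using asymD[OF R(2)] by (intro asymI) auto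
  moreover have "total_on X ?P"
    using R(3) assms(2) by (auto simp: total_on_def)
  moreover have "?P \<subseteq> X \<times> X" by auto
  ultimately have "tournament (with_proj \<lparr>pverts = X, parcs = ?P\<rparr>)"
    using finite_subset[OF assms(2) R(1)] by (simp add: tournament_with_proj_iff)
  moreover have "with_proj T \<restriction> X = with_proj \<lparr>pverts = X, parcs = ?P\<rparr>"
    by (simp add: induce_subgraph_def with_proj_def)
  ultimately show ?thesis by (simp only:)
qed

lemma dominates_induce_subgraph_iff:
  "u \<in> X \<Longrightarrow> v \<in> X \<Longrightarrow> u \<rightarrow>\<^bsub>with_proj T \<restriction> X\<^esub> v \<longleftrightarrow> (u, v) \<in> parcs T"
  by (force simp: arcs_ends_conv)

text \<open>A subset of the vertices induces a tournament, so only the pattern of the arcs remains to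
  be compared.\<close>

lemma num_diamonds_eq_card_diamond_sets:
  assumes T: "tournament (with_proj T)"
  shows "num_diamonds (with_proj T) = card (skew_signs.diamond_sets (pverts T) (arc_sign T))"
proof -
  interpret skew_signs "pverts T" "arc_sign T"
    using T by (rule skew_signs_arc_sign)
  have "diamond (with_proj T \<restriction> X) \<longleftrightarrow> (\<exists>v a b c. X = {v, a, b, c} \<and> diamond_at v a b c)"
    if X: "X \<subseteq> pverts T" "card X = 4" for X
  proof -
    have "diamond (with_proj T \<restriction> X) \<longleftrightarrow> (\<exists>v a b c. X = {v, a, b, c} \<and>
        a \<rightarrow>\<^bsub>with_proj T \<restriction> X\<^esub> b \<and> b \<rightarrow>\<^bsub>with_proj T \<restriction> X\<^esub> c \<and> c \<rightarrow>\<^bsub>with_proj T \<restriction> X\<^esub> a \<and>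
        ((\<forall>x\<in>{a, b, c}. v \<rightarrow>\<^bsub>with_proj T \<restriction> X\<^esub> x) \<or> (\<forall>x\<in>{a, b, c}. x \<rightarrow>\<^bsub>with_proj T \<restriction> X\<^esub> v)))"
      using tournament_induce_subgraph[OF T X(1)] X(2) by (simp add: diamond_def n_tournament_def)
    also have "\<dots> \<longleftrightarrow> (\<exists>v a b c. X = {v, a, b, c} \<and> diamond_at v a b c)"
      by (intro ex_cong1 conj_cong refl)
         (simp add: diamond_at_def dominates_induce_subgraph_iff arc_sign_eq_1_iff[OF T])
    finally show ?thesis .
  qed
  then have "{X. X \<subseteq> verts (with_proj T) \<and> card X = 4 \<and> diamond (with_proj T \<restriction> X)} = diamond_sets"
    unfolding diamond_sets_def with_proj_simps by (intro Collect_cong) (simp cong: conj_cong)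
  then show ?thesis
    by (simp only: num_diamonds_def)
qed

lemma doubly_regular_iff_row_prods:
  assumes T: "tournament (with_proj T)" and n: "card (pverts T) \<ge> 3"
  shows "doubly_regular (with_proj T) \<longleftrightarrow>
    (\<forall>i\<in>pverts T. \<forall>j\<in>pverts T. i \<noteq> j \<longrightarrow> skew_signs.row_prod (pverts T) (arc_sign T) i j = -1)"
proof -
  interpret skew_signs "pverts T" "arc_sign T"
    using T by (rule skew_signs_arc_sign)
  show ?thesis
    unfolding constant_common_out_iff_row_prods[OF n, symmetric]
    by (simp add: doubly_regular_def common_out_def arc_sign_eq_1_iff[OF T])
qed

text \<open>Signs \<open>d\<close> and sets \<open>X\<close> of vertices correspond to each other by \<open>X = {u. d u = -1}\<close>, and
  switching according to \<open>X\<close> multiplies row products by \<open>d i * d j\<close>.\<close>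

lemma switching_equivalent_doubly_regular_iff:
  assumes T: "tournament (with_proj T)" and n: "card (pverts T) \<ge> 3"
  shows "(\<exists>T'. tournament (with_proj T') \<and> doubly_regular (with_proj T') \<and> switching_equivalent T T')
    \<longleftrightarrow> (\<exists>d. (\<forall>i\<in>pverts T. d i = 1 \<or> d i = -1) \<and>
      (\<forall>i\<in>pverts T. \<forall>j\<in>pverts T. i \<noteq> j \<longrightarrow>
        d i * d j * skew_signs.row_prod (pverts T) (arc_sign T) i j = -1))" (is "?L \<longleftrightarrow> ?R")
proof -
  interpret skew_signs "pverts T" "arc_sign T"
    using T by (rule skew_signs_arc_sign)
  define \<chi> :: "'a set \<Rightarrow> 'a \<Rightarrow> int" where "\<chi> X u = (if u \<in> X then -1 else 1)" for X u
  have verts: "pverts (switching T X) = pverts T" for X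
    by (simp add: switching_def)
  have "doubly_regular (with_proj (switching T X)) \<longleftrightarrow>
      (\<forall>i\<in>pverts T. \<forall>j\<in>pverts T. i \<noteq> j \<longrightarrow> \<chi> X i * \<chi> X j * row_prod i j = -1)" for X
  proof -
    have "arc_sign (switching T X) = (\<lambda>u v. \<chi> X u * \<chi> X v * arc_sign T u v)"
      unfolding arc_sign_switching \<chi>_def ..
    moreover have "\<chi> X u = 1 \<or> \<chi> X u = -1" for u
      by (simp add: \<chi>_def)
    ultimately show ?thesis
      using doubly_regular_iff_row_prods[OF tournament_switching[OF T], of X] n
      by (simp add: verts row_prod_switch)
  qed
  then have L: "?L \<longleftrightarrow> (\<exists>X\<subseteq>pverts T. \<forall>i\<in>pverts T. \<forall>j\<in>pverts T. i \<noteq> j \<longrightarrow>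
      \<chi> X i * \<chi> X j * row_prod i j = -1)"
    unfolding switching_equivalent_def using tournament_switching[OF T] by blast
  show ?thesis
    unfolding L
  proof
    assume "\<exists>X\<subseteq>pverts T. \<forall>i\<in>pverts T. \<forall>j\<in>pverts T. i \<noteq> j \<longrightarrow> \<chi> X i * \<chi> X j * row_prod i j = -1"
    then obtain X where "\<forall>i\<in>pverts T. \<forall>j\<in>pverts T. i \<noteq> j \<longrightarrow> \<chi> X i * \<chi> X j * row_prod i j = -1"
      by blast
    then show ?R
      by (intro exI[of _ "\<chi> X"] conjI) (auto simp: \<chi>_def)
  next
    assume ?R
    then obtain d where d: "\<forall>i\<in>pverts T. d i = 1 \<or> d i = -1"
      "\<forall>i\<in>pverts T. \<forall>j\<in>pverts T. i \<noteq> j \<longrightarrow> d i * d j * row_prod i j = -1" by blast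
    define X where "X = {u \<in> pverts T. d u = -1}"
    have "\<chi> X u = d u" if "u \<in> pverts T" for u
      using d(1) that by (auto simp: \<chi>_def X_def)
    then have "\<forall>i\<in>pverts T. \<forall>j\<in>pverts T. i \<noteq> j \<longrightarrow> \<chi> X i * \<chi> X j * row_prod i j = -1"
      using d(2) by simp
    moreover have "X \<subseteq> pverts T" by (auto simp: X_def)
    ultimately show "\<exists>X\<subseteq>pverts T. \<forall>i\<in>pverts T. \<forall>j\<in>pverts T. i \<noteq> j \<longrightarrow>
        \<chi> X i * \<chi> X j * row_prod i j = -1" by blast
  qed
qed

section \<open>The square of the Seidel matrix\<close>

lemma index_mult_square_mat:
  assumes "A \<in> carrier_mat n n" "B \<in> carrier_mat n n" "i < n" "j < n"
  shows "(A * B) $$ (i, j) = (\<Sum>k\<in>{0..<n}. A $$ (i, k) * B $$ (k, j))"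
  using assms by (simp add: scalar_prod_def)

lemma diagonal_conjugation_index:
  fixes D M :: "'a::semiring_0 mat"
  assumes D: "D \<in> carrier_mat n n" "diagonal_mat D" and M: "M \<in> carrier_mat n n"
    and ij: "i < n" "j < n"
  shows "(D * M * D) $$ (i, j) = D $$ (i, i) * M $$ (i, j) * D $$ (j, j)"
proof -
  have DM: "(D * M) $$ (i, l) = D $$ (i, i) * M $$ (i, l)" if l: "l < n" for l
  proof -
    have "(D * M) $$ (i, l) = (\<Sum>k\<in>{0..<n}. D $$ (i, k) * M $$ (k, l))"
      using D(1) M ij(1) l by (rule index_mult_square_mat)
    also have "\<dots> = (\<Sum>k\<in>{0..<n}. if k = i then D $$ (i, i) * M $$ (i, l) else 0)"
      using D ij by (intro sum.cong refl) (auto simp: diagonal_mat_def)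
    finally show ?thesis using ij by simp
  qed
  have "(D * M * D) $$ (i, j) = (\<Sum>l\<in>{0..<n}. (D * M) $$ (i, l) * D $$ (l, j))"
    using mult_carrier_mat[OF D(1) M] D(1) ij by (rule index_mult_square_mat)
  also have "\<dots> = (\<Sum>l\<in>{0..<n}. if l = j then D $$ (i, i) * M $$ (i, j) * D $$ (j, j) else 0)"
    using D ij DM by (intro sum.cong refl) (auto simp: diagonal_mat_def)
  finally show ?thesis using ij by simp
qed

lemma seidel_mat_carrier: "seidel_mat n lab G \<in> carrier_mat n n"
  by (rule carrier_matI) (simp_all add: seidel_mat_def adjacency_mat_def)

lemma seidel_mat_index:
  assumes "i < n" "j < n"
  shows "seidel_mat n lab (with_proj T) $$ (i, j) = real_of_int (arc_sign T (lab i) (lab j))"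
  using assms by (simp add: seidel_mat_def adjacency_mat_def arc_sign_def)

lemma seidel_mat_square_index:
  assumes T: "tournament (with_proj T)" and lab: "bij_betw lab {0..<n} (pverts T)"
    and ij: "i < n" "j < n"
  shows "(seidel_mat n lab (with_proj T) ^\<^sub>m 2) $$ (i, j)
    = - real_of_int (skew_signs.row_prod (pverts T) (arc_sign T) (lab i) (lab j))"
proof -
  interpret skew_signs "pverts T" "arc_sign T"
    using T by (rule skew_signs_arc_sign)
  let ?S = "seidel_mat n lab (with_proj T)"
  have S: "?S \<in> carrier_mat n n"
    by (rule seidel_mat_carrier)
  have mem: "lab k \<in> pverts T" if "k < n" for k
    using lab that by (auto simp: bij_betw_def)
  have "?S ^\<^sub>m 2 = ?S * ?S"
    using S by (simp add: numeral_2_eq_2)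
  then have "(?S ^\<^sub>m 2) $$ (i, j) = (\<Sum>k\<in>{0..<n}. ?S $$ (i, k) * ?S $$ (k, j))"
    using index_mult_square_mat[OF S S ij] by simp
  also have "\<dots> = (\<Sum>k\<in>{0..<n}. - real_of_int (arc_sign T (lab i) (lab k) * arc_sign T (lab j) (lab k)))"
  proof (rule sum.cong[OF refl])
    fix k assume "k \<in> {0..<n}"
    then have k: "k < n" by simp
    show "?S $$ (i, k) * ?S $$ (k, j)
        = - real_of_int (arc_sign T (lab i) (lab k) * arc_sign T (lab j) (lab k))"
      using skew[OF mem[OF ij(2)] mem[OF k]]
      by (simp add: seidel_mat_index[OF ij(1) k] seidel_mat_index[OF k ij(2)])
  qed
  also have "\<dots> = - real_of_int (\<Sum>k\<in>{0..<n}. arc_sign T (lab i) (lab k) * arc_sign T (lab j) (lab k))"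
    by (simp add: sum_negf)
  also have "\<dots> = - real_of_int (row_prod (lab i) (lab j))"
    unfolding row_prod_def
    using sum.reindex_bij_betw[OF lab, of "\<lambda>u. arc_sign T (lab i) u * arc_sign T (lab j) u"]
    by (simp only:)
  finally show ?thesis .
qed

text \<open>
  The entry of \<open>D S\<^sup>2 D + n I\<close> at \<open>(i, j)\<close> is \<open>- d i * d j * row_prod i j\<close>, plus \<open>n\<close> on the
  diagonal. There the row product is \<open>n - 1\<close>, so the entry is \<open>1\<close> for every choice of signs;
  off the diagonal the equation with \<open>J\<close> is the condition on row products.
\<close>

lemma signed_seidel_square_iff:
  assumes T: "tournament (with_proj T)" and lab: "bij_betw lab {0..<n} (pverts T)"
    and S: "S = seidel_mat n lab (with_proj T)"
  shows "(\<exists>D\<in>carrier_mat n n. diagonal_mat D \<and> (\<forall>i<n. D $$ (i, i) \<in> {-1, 1}) \<and>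
             D * (S ^\<^sub>m 2) * D + real n \<cdot>\<^sub>m 1\<^sub>m n = all_ones_mat n)
    \<longleftrightarrow> (\<exists>d. (\<forall>i\<in>pverts T. d i = 1 \<or> d i = -1) \<and>
      (\<forall>i\<in>pverts T. \<forall>j\<in>pverts T. i \<noteq> j \<longrightarrow>
        d i * d j * skew_signs.row_prod (pverts T) (arc_sign T) i j = -1))" (is "?L \<longleftrightarrow> ?R")
proof -
  interpret skew_signs "pverts T" "arc_sign T"
    using T by (rule skew_signs_arc_sign)
  have card: "card (pverts T) = n"
    using bij_betw_same_card[OF lab] by simp
  have inj: "lab i = lab j \<longleftrightarrow> i = j" if "i < n" "j < n" for i j
    using lab that by (auto simp: bij_betw_def inj_on_def)
  have range: "pverts T = lab ` {0..<n}"
    using lab by (simp add: bij_betw_def)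
  have S_carrier: "S ^\<^sub>m 2 \<in> carrier_mat n n"
    unfolding S by (intro pow_carrier_mat seidel_mat_carrier)
  have equation: "D * (S ^\<^sub>m 2) * D + real n \<cdot>\<^sub>m 1\<^sub>m n = all_ones_mat n \<longleftrightarrow>
      (\<forall>i\<in>pverts T. \<forall>j\<in>pverts T. i \<noteq> j \<longrightarrow> d i * d j * row_prod i j = -1)"
    if D: "D \<in> carrier_mat n n" "diagonal_mat D"
      and d: "\<And>i. i < n \<Longrightarrow> real_of_int (d (lab i)) = D $$ (i, i)"
      and pm: "\<And>i. i < n \<Longrightarrow> d (lab i) = 1 \<or> d (lab i) = -1" for D d
  proof -
    let ?M = "D * (S ^\<^sub>m 2) * D + real n \<cdot>\<^sub>m 1\<^sub>m n"
    have entry: "?M $$ (i, j) = real_of_int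
        (- (d (lab i) * d (lab j) * row_prod (lab i) (lab j)) + (if i = j then int n else 0))"
      if ij: "i < n" "j < n" for i j
    proof -
      have "?M $$ (i, j) = (D * (S ^\<^sub>m 2) * D) $$ (i, j) + (if i = j then real n else 0)"
        using D ij by (subst index_add_mat) auto
      then show ?thesis
        using diagonal_conjugation_index[OF D S_carrier ij]
          seidel_mat_square_index[OF T lab ij] ij by (simp add: S d)
    qed
    have "?M = all_ones_mat n \<longleftrightarrow> (\<forall>i<n. \<forall>j<n. ?M $$ (i, j) = 1)"
      using D by (auto simp: all_ones_mat_def mat_eq_iff simp del: index_add_mat(1) index_mult_mat(1))
    also have "\<dots> \<longleftrightarrow> (\<forall>i<n. \<forall>j<n. i \<noteq> j \<longrightarrow> d (lab i) * d (lab j) * row_prod (lab i) (lab j) = -1)"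
    proof (intro all_cong1 imp_cong refl)
      fix i j assume ij: "i < n" "j < n"
      show "?M $$ (i, j) = 1 \<longleftrightarrow> (i \<noteq> j \<longrightarrow> d (lab i) * d (lab j) * row_prod (lab i) (lab j) = -1)"
      proof (cases "i = j")
        case True
        have "d (lab i) * d (lab i) = 1" using pm[OF ij(1)] by auto
        moreover have "lab i \<in> pverts T" using ij range by simp
        ultimately show ?thesis
          using entry[OF ij] True row_prod_self card by simp
      next
        case False
        have "?M $$ (i, j) = real_of_int (- (d (lab i) * d (lab j) * row_prod (lab i) (lab j)))"
          using entry[OF ij] False by simp
        then show ?thesis using False by linarith
      qed
    qed
    also have "\<dots> \<longleftrightarrow> (\<forall>i\<in>pverts T. \<forall>j\<in>pverts T. i \<noteq> j \<longrightarrow> d i * d j * row_prod i j = -1)"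
      unfolding range using inj by auto
    finally show ?thesis .
  qed
  show ?thesis
  proof
    assume ?L
    then obtain D where D: "D \<in> carrier_mat n n" "diagonal_mat D"
      and pm: "\<forall>i<n. D $$ (i, i) \<in> {-1, 1}"
      and eq: "D * (S ^\<^sub>m 2) * D + real n \<cdot>\<^sub>m 1\<^sub>m n = all_ones_mat n"
      by blast
    define d :: "'a \<Rightarrow> int" where
      "d u = (let i = inv_into {0..<n} lab u in if D $$ (i, i) = 1 then 1 else -1)" for u
    have "inv_into {0..<n} lab (lab i) = i" if "i < n" for i
      using lab that by (simp add: bij_betw_def)
    then have "real_of_int (d (lab i)) = D $$ (i, i)" if "i < n" for i
      using pm that by (auto simp: d_def)
    moreover have d_pm: "d u = 1 \<or> d u = -1" for u
      by (simp add: d_def Let_def)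
    ultimately have "\<forall>i\<in>pverts T. \<forall>j\<in>pverts T. i \<noteq> j \<longrightarrow> d i * d j * row_prod i j = -1"
      by (rule equation[OF D, THEN iffD1, OF _ _ eq])
    then show ?R
      using d_pm by (intro exI[of _ d]) simp
  next
    assume ?R
    then obtain d where pm: "\<forall>i\<in>pverts T. d i = 1 \<or> d i = -1"
      and eq: "\<forall>i\<in>pverts T. \<forall>j\<in>pverts T. i \<noteq> j \<longrightarrow> d i * d j * row_prod i j = -1"
      by blast
    define D where "D = mat n n (\<lambda>(i, j). if i = j then real_of_int (d (lab i)) else 0)"
    have D: "D \<in> carrier_mat n n" "diagonal_mat D"
      by (auto simp: D_def diagonal_mat_def)
    have entries: "real_of_int (d (lab i)) = D $$ (i, i)" "d (lab i) = 1 \<or> d (lab i) = -1"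
      if "i < n" for i
      using that pm range by (auto simp: D_def)
    have "D $$ (i, i) \<in> {-1, 1}" if "i < n" for i
      using entries[OF that] by auto
    moreover have "D * (S ^\<^sub>m 2) * D + real n \<cdot>\<^sub>m 1\<^sub>m n = all_ones_mat n"
      by (rule iffD2[OF equation[of D d]]) (fact D entries eq)+
    ultimately show ?L
      using D by blast
  qed
qed

theorem theorem10:
  fixes T :: "'a pair_pre_digraph" and n :: nat and lab :: "nat \<Rightarrow> 'a" and S :: "real mat"
  assumes "n_tournament n (with_proj T)"
    and "bij_betw lab {0..<n} (pverts T)"
    and "S = seidel_mat n lab (with_proj T)"
    and "n mod 4 = 3"
  shows "(real (num_diamonds (with_proj T)) =
            1 / 96 * real n * (real n - 1) * (real n - 3) * (real n + 1)
          \<longleftrightarrow>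
          (\<exists>D\<in>carrier_mat n n. diagonal_mat D \<and> (\<forall>i<n. D $$ (i, i) \<in> {-1, 1}) \<and>
             D * (S ^\<^sub>m 2) * D + real n \<cdot>\<^sub>m 1\<^sub>m n = all_ones_mat n))
       \<and> (real (num_diamonds (with_proj T)) =
            1 / 96 * real n * (real n - 1) * (real n - 3) * (real n + 1)
          \<longleftrightarrow>
          (\<exists>T'. tournament (with_proj T') \<and> doubly_regular (with_proj T') \<and>
             switching_equivalent T T'))"
proof -
  have T: "tournament (with_proj T)" and card: "card (pverts T) = n"
    using assms(1) by (simp_all add: n_tournament_def)
  interpret skew_signs "pverts T" "arc_sign T"
    using T by (rule skew_signs_arc_sign)
  have n: "card (pverts T) mod 4 = 3" "odd (card (pverts T))" "card (pverts T) \<ge> 3"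
    using assms(4) unfolding card by presburger+
  have "real (num_diamonds (with_proj T)) =
      1 / 96 * real n * (real n - 1) * (real n - 3) * (real n + 1)
    \<longleftrightarrow> (\<exists>d. (\<forall>i\<in>pverts T. d i = 1 \<or> d i = -1) \<and>
      (\<forall>i\<in>pverts T. \<forall>j\<in>pverts T. i \<noteq> j \<longrightarrow> d i * d j * row_prod i j = -1))"
    using diamond_count_iff_row_prods_pm1[OF n(2)] row_prods_pm1_iff_switchable[OF n(1)]
    unfolding num_diamonds_eq_card_diamond_sets[OF T] card by (simp only:)
  then show ?thesis
    unfolding signed_seidel_square_iff[OF T assms(2,3)]
      switching_equivalent_doubly_regular_iff[OF T n(3)]
    by blast
qed

end
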